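(* Consider any instance of the congestion game in which every resource uses the Rand policy, and let $x$ be any (mixed) Nash equilibrium of it. Then there exists a feasible solution of (SDP-SR) with objective value at least $\frac{15}{32}\,C(x)$, where $C$ is the social cost under Rand. This implies that the coordination ratio is at most $\frac{32}{15}$, i.e. $C(x)\le\frac{32}{15}\,C^{SR}(x^* )$ for every Nash equilibrium $x$ and every pure assignment $x^*$, where $C^{SR}$ is the social cost under Smith's Rule.
   Context: Congestion model. $N$ is a finite set of players and $E$ a finite set of resources. Each player $j\in N$ has a weight $w_j>0$, a nonempty strategy set $\mathcal S_j\subseteq 2^E$, and processing times $p_{ej}\in[0,\infty]$ $(e\in E)$, with $p_{ej}<\infty$ whenever $e$ belongs to some strategy $i\in\mathcal S_j$. The Smith ratio is $\delta_{ej}=p_{ej}/w_j$. For each $e\in E$, $\prec_e$ is a strict total order on $N$ such that $k\prec_e j$ implies $\delta_{ek}\le\delta_{ej}$ (ties broken consistently). An assignment is $x=(x_{ij})_{j\in N,i\in\mathcal S_j}$ with $x_{ij}\ge 0$ and $\sum_{i\in\mathcal S_j}x_{ij}=1$ for all $j$ ($x_{ij}$ is the probability that $j$ independently chooses $i$); it is pure if all $x_{ij}\in\{0,1\}$. Put $z_{ej}=\sum_{i\in\mathcal S_j:\,e\in i}x_{ij}$. Terms containing a factor $z_{ek}=0$ are read as $0$. Rand. Each resource orders its players randomly so that $j$ comes after $k$ with probability $\delta_{ej}/(\delta_{ej}+\delta_{ek})$. The (expected) cost of player $j$ is $$C_j(x)=\sum_{i\in\mathcal S_j}x_{ij}\sum_{e\in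 i}\Big(p_{ej}+\sum_{k\ne j}\frac{\delta_{ej}}{\delta_{ej}+\delta_{ek}}\,p_{ek}z_{ek}\Big)$$ (a summand with $\delta_{ej}=\delta_{ek}=0$ is $0$, since then $p_{ek}=0$), and the social cost is $C(x)=\sum_{j\in N}w_jC_j(x)$. Nash equilibrium. $x$ is a (mixed) Nash equilibrium if $C_j(x)\le C_j(x_{-j},i)$ for all $j\in N$, $i\in\mathcal S_j$, where $(x_{-j},i)$ is obtained from $x$ by letting $j$ choose $i$ with probability $1$. Smith's Rule social cost: $C^{SR}(x)=\sum_{j\in N}w_j\sum_{i\in\mathcal S_j}x_{ij}\sum_{e\in i}\big(p_{ej}+\sum_{k\prec_e j}p_{ek}z_{ek}\big)$. The coordination ratio is the worst ratio between $C(x)$ for a Nash equilibrium $x$ (under the given policy) and the minimum of $C^{SR}$ over pure assignments. (SDP-SR): the variables are reals $y_j$ $(j\in N)$ and vectors $v_0, v_{ij}\in\mathbb R^d$ $(j\in N,i\in\mathcal S_j)$ for some $d\in\mathbb N$, with the standard inner product. Maximize $\sum_{j\in N}y_j-\frac12\|v_0\|^2$ subject to $y_j\le\sum_{e\in i}w_jp_{ej}-\frac12\|v_{ij}\|^2+\langle v_0,v_{ij}\rangle$ for all $j\in N,i\in\mathcal S_j$; and $\langle v_{ij},v_{i'k}\rangle\le\sum_{e\in i\cap i'}w_jw_k\min\{\delta_{ej},\delta_{ek}\}$ for all $(i,j)\ne(i',k)$ with $j,k\in N$, $i\in\mathcal S_j$, $i'\in\mathcal S_k$. *)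

theory Defs
  imports "HOL-Library.Extended_Nonnegative_Real" "Jordan_Normal_Form.Matrix"
begin

record ('e, 'j) congestion_instance =
  players :: "'j set"
  resources :: "'e set"
  weight :: "'j \<Rightarrow> real"
  strategies :: "'j \<Rightarrow> 'e set set"
  ptime :: "'e \<Rightarrow> 'j \<Rightarrow> ennreal"
  prec :: "'e \<Rightarrow> ('j \<times> 'j) set"  (* (k, j) \<in> prec G e means that k precedes j on e *)

definition smith :: "('e, 'j) congestion_instance \<Rightarrow> 'e \<Rightarrow> 'j \<Rightarrow> ennreal" where
  "smith G e j = ptime G e j / ennreal (weight G j)"

definition congestion_game :: "('e, 'j) congestion_instance \<Rightarrow> bool" where
  "congestion_game G \<longleftrightarrow>
     finite (players G) \<and> finite (resources G) \<and>
     (\<forall>j\<in>players G.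
        weight G j > 0 \<and> strategies G j \<noteq> {} \<and> strategies G j \<subseteq> Pow (resources G) \<and>
        (\<forall>i\<in>strategies G j. \<forall>e\<in>i. ptime G e j < \<infinity>)) \<and>
     (\<forall>e\<in>resources G.
        prec G e \<subseteq> players G \<times> players G \<and>
        strict_linear_order_on (players G) (prec G e) \<and>
        (\<forall>(k, j)\<in>prec G e. smith G e k \<le> smith G e j))"

(* Real-valued versions of the data, sending \<infinity> to 0. In the costs and in the SDP below they are
   only relevant at pairs (e, j) where e lies in some strategy of j, so that the value is finite:
   every other occurrence is multiplied by load G x e j = 0, and such terms are read as 0. *)
definition rtime :: "('e, 'j) congestion_instance \<Rightarrow> 'e \<Rightarrow> 'j \<Rightarrow> real" where
  "rtime G e j = enn2real (ptime G e j)"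

definition rsmith :: "('e, 'j) congestion_instance \<Rightarrow> 'e \<Rightarrow> 'j \<Rightarrow> real" where
  "rsmith G e j = enn2real (smith G e j)"

(* x j i is the probability that player j chooses strategy i; values at j outside players G or
   i outside strategies G j are irrelevant. *)
definition assignment :: "('e, 'j) congestion_instance \<Rightarrow> ('j \<Rightarrow> 'e set \<Rightarrow> real) \<Rightarrow> bool" where
  "assignment G x \<longleftrightarrow>
     (\<forall>j\<in>players G. (\<forall>i\<in>strategies G j. 0 \<le> x j i) \<and> (\<Sum>i\<in>strategies G j. x j i) = 1)"

definition pure_assignment :: "('e, 'j) congestion_instance \<Rightarrow> ('j \<Rightarrow> 'e set \<Rightarrow> real) \<Rightarrow> bool" where
  "pure_assignment G x \<longleftrightarrow>
     assignment G x \<and> (\<forall>j\<in>players G. \<forall>i\<in>strategies G j. x j i \<in> {0, 1})"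

definition load ::
  "('e, 'j) congestion_instance \<Rightarrow> ('j \<Rightarrow> 'e set \<Rightarrow> real) \<Rightarrow> 'e \<Rightarrow> 'j \<Rightarrow> real" where
  "load G x e j = (\<Sum>i\<in>{i\<in>strategies G j. e \<in> i}. x j i)"

(* If both Smith ratios vanish, the quotient is 0 / 0 = 0. *)
definition rand_cost ::
  "('e, 'j) congestion_instance \<Rightarrow> ('j \<Rightarrow> 'e set \<Rightarrow> real) \<Rightarrow> 'j \<Rightarrow> real" where
  "rand_cost G x j =
     (\<Sum>i\<in>strategies G j. x j i *
        (\<Sum>e\<in>i. rtime G e j +
           (\<Sum>k\<in>players G - {j}.
              rsmith G e j / (rsmith G e j + rsmith G e k) * rtime G e k * load G x e k)))"

definition rand_social_cost ::
  "('e, 'j) congestion_instance \<Rightarrow> ('j \<Rightarrow> 'e set \<Rightarrow> real) \<Rightarrow> real" where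
  "rand_social_cost G x = (\<Sum>j\<in>players G. weight G j * rand_cost G x j)"

definition deviate ::
  "('j \<Rightarrow> 'e set \<Rightarrow> real) \<Rightarrow> 'j \<Rightarrow> 'e set \<Rightarrow> 'j \<Rightarrow> 'e set \<Rightarrow> real" where
  "deviate x j i = x(j := (\<lambda>i'. if i' = i then 1 else 0))"

definition rand_nash :: "('e, 'j) congestion_instance \<Rightarrow> ('j \<Rightarrow> 'e set \<Rightarrow> real) \<Rightarrow> bool" where
  "rand_nash G x \<longleftrightarrow>
     assignment G x \<and>
     (\<forall>j\<in>players G. \<forall>i\<in>strategies G j. rand_cost G x j \<le> rand_cost G (deviate x j i) j)"

definition smith_social_cost ::
  "('e, 'j) congestion_instance \<Rightarrow> ('j \<Rightarrow> 'e set \<Rightarrow> real) \<Rightarrow> real" where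
  "smith_social_cost G x =
     (\<Sum>j\<in>players G. weight G j *
        (\<Sum>i\<in>strategies G j. x j i *
           (\<Sum>e\<in>i. rtime G e j +
              (\<Sum>k\<in>{k\<in>players G. (k, j) \<in> prec G e}. rtime G e k * load G x e k))))"

(* Up to values outside the game there are only finitely many pure assignments, so the infimum is
   a minimum. All costs are nonnegative, and a ratio a / 0 is \<infinity> for a > 0 and 0 for a = 0. *)
definition rand_coordination_ratio :: "('e, 'j) congestion_instance \<Rightarrow> ennreal" where
  "rand_coordination_ratio G =
     (SUP x\<in>{x. rand_nash G x}.
        ennreal (rand_social_cost G x) /
        (INF x'\<in>{x'. pure_assignment G x'}. ennreal (smith_social_cost G x')))"

definition sdp_sr_feasible ::
  "('e, 'j) congestion_instance \<Rightarrow> nat \<Rightarrow> ('j \<Rightarrow> real) \<Rightarrow> real vec \<Rightarrow> ('j \<Rightarrow> 'e set \<Rightarrow> real vec) \<Rightarrow> bool"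
  where
  "sdp_sr_feasible G d y v0 v \<longleftrightarrow>
     v0 \<in> carrier_vec d \<and>
     (\<forall>j\<in>players G. \<forall>i\<in>strategies G j. v j i \<in> carrier_vec d) \<and>
     (\<forall>j\<in>players G. \<forall>i\<in>strategies G j.
        y j \<le> (\<Sum>e\<in>i. weight G j * rtime G e j) - 1/2 * (v j i \<bullet> v j i) + v0 \<bullet> v j i) \<and>
     (\<forall>j\<in>players G. \<forall>k\<in>players G. \<forall>i\<in>strategies G j. \<forall>i'\<in>strategies G k.
        (i, j) \<noteq> (i', k) \<longrightarrow>
        v j i \<bullet> v k i' \<le>
          (\<Sum>e\<in>i \<inter> i'. weight G j * weight G k * min (rsmith G e j) (rsmith G e k)))"

definition sdp_sr_objective ::
  "('e, 'j) congestion_instance \<Rightarrow> ('j \<Rightarrow> real) \<Rightarrow> real vec \<Rightarrow> real" where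
  "sdp_sr_objective G y v0 = (\<Sum>j\<in>players G. y j) - 1/2 * (v0 \<bullet> v0)"

end

theory Submission
  imports Defs
begin

text \<open>
  Multiplying by the weights turns the Rand interaction of two players on a resource into
  \<open>w\<^sub>j w\<^sub>k par \<delta>\<^sub>j \<delta>\<^sub>k\<close> with the symmetric kernel \<open>par a b = a b / (a + b)\<close>. This kernel is positive
  semidefinite, so \<open>par a b = \<langle>\<phi>\<^sub>a, \<phi>\<^sub>b\<rangle>\<close> for suitable vectors, and it is bounded by \<open>min a b\<close>.
  Placing a separate copy of these vectors on each resource, take
  \<open>v\<^sub>i\<^sub>j = \<Sum>\<^sub>e\<^sub>\<in>\<^sub>i w\<^sub>j \<phi>(\<delta>\<^sub>e\<^sub>j)\<close>, \<open>v\<^sub>0 = 3/4 \<Sum>\<^sub>e\<^sub>,\<^sub>k z\<^sub>e\<^sub>k w\<^sub>k \<phi>(\<delta>\<^sub>e\<^sub>k)\<close> and \<open>y\<^sub>j = 3/4 w\<^sub>j C\<^sub>j(x)\<close>.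
  Since \<open>par a a = a / 2\<close>, the norm of \<open>v\<^sub>i\<^sub>j\<close> costs a quarter of the processing term, which leaves
  exactly the factor 3/4 for the Nash inequality; and \<open>\<parallel>v\<^sub>0\<parallel>\<^sup>2 \<le> 9/16 C(x)\<close>, so the objective is at
  least \<open>(3/4 - 9/32) C(x) = 15/32 C(x)\<close>. Completing the square in \<open>v\<^sub>0\<close> shows that every feasible
  objective value is at most the Smith's Rule cost of any pure assignment.
\<close>

section \<open>The kernel \<open>par\<close>: bounds and Gram vectors\<close>

text \<open>Junk value: \<open>par 0 0 = 0\<close>, in agreement with the convention of the cost function.\<close>

definition par :: "real \<Rightarrow> real \<Rightarrow> real" where
  "par a b = a * b / (a + b)"

lemma par_commute: "par a b = par b a"
  by (simp add: par_def mult.commute add.commute)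

lemma par_self: "par a a = a / 2"
  by (simp add: par_def)

lemma par_nonneg: "0 \<le> a \<Longrightarrow> 0 \<le> b \<Longrightarrow> 0 \<le> par a b"
  by (simp add: par_def)

lemma par_le_left:
  assumes "0 \<le> a" "0 \<le> b"
  shows "par a b \<le> a"
proof (cases "a + b = 0")
  case True
  then show ?thesis using assms by (simp add: par_def)
next
  case False
  then have "a + b > 0" using assms by simp
  then show ?thesis using assms by (simp add: par_def field_simps)
qed

lemma par_le_min: "0 \<le> a \<Longrightarrow> 0 \<le> b \<Longrightarrow> par a b \<le> min a b"
  using par_le_left[of a b] par_le_left[of b a] by (simp add: par_commute)

text \<open>
  One elimination step for the Cauchy-type matrix with entries \<open>par a c\<close>: subtracting the rank-one
  term with pivot \<open>b\<close> leaves the same kernel, rescaled by \<open>(a - b) / (a + b)\<close> on each side.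
\<close>

lemma par_schur_complement:
  assumes "0 \<le> a" "0 \<le> b" "0 \<le> c"
  shows "(sqrt (2 * b) * a / (a + b)) * (sqrt (2 * b) * c / (c + b))
           + ((a - b) / (a + b)) * ((c - b) / (c + b)) * par a c = par a c"
proof -
  have sq: "sqrt (2 * b) * sqrt (2 * b) = 2 * b" using assms by simp
  have "(sqrt (2 * b) * a / (a + b)) * (sqrt (2 * b) * c / (c + b))
          = (sqrt (2 * b) * sqrt (2 * b)) * a * c / ((a + b) * (c + b))"
    by simp
  also have "\<dots> = 2 * b * a * c / ((a + b) * (c + b))"
    by (simp only: sq)
  finally have 1: "(sqrt (2 * b) * a / (a + b)) * (sqrt (2 * b) * c / (c + b))
                     = 2 * b * a * c / ((a + b) * (c + b))" .
  show ?thesis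
  \<comment> \<open>If \<open>a\<close> or \<open>c\<close> is zero, all terms vanish, whatever the
    denominators; otherwise no denominator is zero.\<close>
  proof (cases "a = 0 \<or> c = 0")
    case True
    then show ?thesis by (auto simp: par_def)
  next
    case False
    then have "a + b \<noteq> 0" "c + b \<noteq> 0" "a + c \<noteq> 0" using assms by auto
    then show ?thesis unfolding 1 par_def
      by (simp add: divide_simps) (simp add: algebra_simps)
  qed
qed

text \<open>Positive semidefiniteness by symmetric elimination: each inserted pivot \<open>b\<close>
  contributes one new coordinate, and the coordinates obtained so far are rescaled by
  \<open>(a - b) / (a + b)\<close>, so that together they reproduce the kernel.\<close>

lemma par_gram:
  assumes "finite D" "\<And>a. a \<in> D \<Longrightarrow> 0 \<le> a"
  shows "\<exists>u. \<forall>a\<in>D. \<forall>c\<in>D. (\<Sum>b\<in>D. u a b * u c b) = par a c"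
  using assms
proof (induction D rule: finite_induct)
  case empty
  then show ?case by simp
next
  case (insert b D)
  then obtain u where u: "\<And>a c. a \<in> D \<Longrightarrow> c \<in> D \<Longrightarrow> (\<Sum>d\<in>D. u a d * u c d) = par a c"
    by auto
  define u' where "u' a d = (if d = b then sqrt (2 * b) * a / (a + b)
                             else (a - b) / (a + b) * u a d)" for a d
  have "(\<Sum>d\<in>insert b D. u' a d * u' c d) = par a c"
    if ac: "a \<in> insert b D" "c \<in> insert b D" for a c
  proof -
    have "(\<Sum>d\<in>D. u' a d * u' c d)
            = (\<Sum>d\<in>D. ((a - b) / (a + b)) * ((c - b) / (c + b)) * (u a d * u c d))"
      using insert.hyps by (intro sum.cong) (auto simp: u'_def)
    also have "\<dots> = ((a - b) / (a + b)) * ((c - b) / (c + b)) * (\<Sum>d\<in>D. u a d * u c d)"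
      by (simp add: sum_distrib_left)
    \<comment> \<open>If \<open>a\<close> or \<open>c\<close> is the pivot, its factor is 0;
      otherwise both lie in \<open>D\<close> and the induction hypothesis applies.\<close>
    also have "\<dots> = ((a - b) / (a + b)) * ((c - b) / (c + b)) * par a c"
      using ac u by (cases "a = b \<or> c = b") auto
    finally have "(\<Sum>d\<in>insert b D. u' a d * u' c d)
        = (sqrt (2 * b) * a / (a + b)) * (sqrt (2 * b) * c / (c + b))
          + ((a - b) / (a + b)) * ((c - b) / (c + b)) * par a c"
      using insert.hyps by (simp add: u'_def)
    also have "\<dots> = par a c"
      using insert.prems ac by (intro par_schur_complement) auto
    finally show ?thesis .
  qed
  then show ?case by blast
qed

text \<open>The SDP asks for vectors with numeric indices, while the construction below has
  coordinates indexed by pairs of a resource and a Smith ratio; an enumeration of the index set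
  translates between the two.\<close>

lemma finite_index_vec:
  assumes "finite I"
  shows "\<exists>g :: ('i \<Rightarrow> real) \<Rightarrow> real vec.
           (\<forall>f. g f \<in> carrier_vec (card I)) \<and>
           (\<forall>f f'. g f \<bullet> g f' = (\<Sum>i\<in>I. f i * f' i))"
proof -
  obtain h where h: "bij_betw h {0..<card I} I"
    using ex_bij_betw_nat_finite[OF assms] by blast
  show ?thesis
    by (rule exI[of _ "\<lambda>f. vec (card I) (\<lambda>n. f (h n))"])
       (simp add: scalar_prod_def sum.reindex_bij_betw[OF h, of "\<lambda>i. _ i * _ i"])
qed

lemma sum_split_diagonal:
  fixes f :: "'a \<Rightarrow> 'a \<Rightarrow> real"
  assumes "finite A"
  shows "(\<Sum>a\<in>A. \<Sum>b\<in>A. f a b) = (\<Sum>a\<in>A. f a a) + (\<Sum>a\<in>A. \<Sum>b\<in>A - {a}. f a b)"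
  using assms by (simp add: sum.remove sum.distrib)

text \<open>Of two distinct elements exactly one precedes the other, so the right-hand sum meets
  each unordered pair once and the left-hand sum meets it twice. This turns symmetric interactions
  into waiting terms of Smith's Rule.\<close>

lemma sum_symmetric_strict_linear_order:
  fixes f :: "'a \<Rightarrow> 'a \<Rightarrow> real"
  assumes fin: "finite A" and r: "strict_linear_order_on A r"
    and sym: "\<And>a b. a \<in> A \<Longrightarrow> b \<in> A \<Longrightarrow> f a b = f b a"
  shows "(\<Sum>a\<in>A. \<Sum>b\<in>A - {a}. f a b) = 2 * (\<Sum>a\<in>A. \<Sum>b\<in>{b \<in> A. (b, a) \<in> r}. f a b)"
proof -
  have tr: "trans r" and irr: "irrefl r" and tot: "total_on A r"
    using r by (auto simp: strict_linear_order_on_def)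
  have "(\<Sum>b\<in>A - {a}. f a b)
      = (\<Sum>b\<in>{b \<in> A. (b, a) \<in> r}. f a b) + (\<Sum>b\<in>{b \<in> A. (a, b) \<in> r}. f a b)"
    if "a \<in> A" for a
  proof -
    have "A - {a} = {b \<in> A. (b, a) \<in> r} \<union> {b \<in> A. (a, b) \<in> r}"
      using tot irr that by (auto simp: total_on_def irrefl_def)
    moreover have "{b \<in> A. (b, a) \<in> r} \<inter> {b \<in> A. (a, b) \<in> r} = {}"
      using tr irr by (auto simp: irrefl_def dest: transD)
    ultimately show ?thesis using fin by (simp add: sum.union_disjoint)
  qed
  moreover have "(\<Sum>a\<in>A. \<Sum>b\<in>{b \<in> A. (a, b) \<in> r}. f a b)
      = (\<Sum>b\<in>A. \<Sum>a\<in>{a \<in> A. (a, b) \<in> r}. f a b)"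
    using fin by (intro sum.swap_restrict)
  moreover have "\<dots> = (\<Sum>b\<in>A. \<Sum>a\<in>{a \<in> A. (a, b) \<in> r}. f b a)"
    using sym by (intro sum.cong) auto
  ultimately show ?thesis by (simp add: sum.distrib)
qed

section \<open>Elementary facts and Rand costs of a fixed game\<close>

context
  fixes G :: "('e, 'j) congestion_instance"
  assumes game: "congestion_game G"
begin

lemma finite_players: "finite (players G)"
  using game by (simp add: congestion_game_def)

lemma finite_resources: "finite (resources G)"
  using game by (simp add: congestion_game_def)

lemma weight_pos: "j \<in> players G \<Longrightarrow> 0 < weight G j"
  using game by (simp add: congestion_game_def)

lemma strategy_subset: "j \<in> players G \<Longrightarrow> i \<in> strategies G j \<Longrightarrow> i \<subseteq> resources G"
  using game by (auto simp: congestion_game_def)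

lemma finite_strategy: "j \<in> players G \<Longrightarrow> i \<in> strategies G j \<Longrightarrow> finite i"
  using strategy_subset finite_resources finite_subset by metis

lemma finite_strategies: "j \<in> players G \<Longrightarrow> finite (strategies G j)"
  using strategy_subset finite_resources by (auto intro: finite_subset[of _ "Pow (resources G)"])

lemma rsmith_nonneg: "0 \<le> rsmith G e j"
  by (simp add: rsmith_def)

text \<open>For an infinite processing time the Smith ratio is infinite too, and both conversions to
  reals give 0, so the identity holds at every resource.\<close>

lemma rtime_eq:
  assumes "j \<in> players G"
  shows "rtime G e j = weight G j * rsmith G e j"
proof -
  have w: "weight G j > 0" using weight_pos[OF assms] .
  show ?thesis
  proof (cases "ptime G e j" rule: ennreal_cases)
    case (real r)
    then show ?thesis using w
      by (simp add: rtime_def rsmith_def smith_def divide_ennreal)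
  next
    case top
    then show ?thesis using w
      by (simp add: rtime_def rsmith_def smith_def ennreal_top_divide)
  qed
qed

text \<open>As \<open>enn2real\<close> sends infinity to 0, it preserves an inequality only if the
  larger side is finite; this is where membership of \<open>e\<close> in a strategy of
  \<open>j\<close> enters.\<close>

lemma rsmith_mono_prec:
  assumes "j \<in> players G" "i \<in> strategies G j" "e \<in> i" "(k, j) \<in> prec G e"
  shows "rsmith G e k \<le> rsmith G e j"
proof -
  have e: "e \<in> resources G" using assms strategy_subset by blast
  have le: "smith G e k \<le> smith G e j"
    using game e assms(4) by (auto simp: congestion_game_def)
  have "ptime G e j < \<infinity>" using game assms(1-3) by (auto simp: congestion_game_def)
  then have "smith G e j < \<infinity>"
    using weight_pos[OF assms(1)]
    by (cases "ptime G e j" rule: ennreal_cases) (auto simp: smith_def divide_ennreal)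
  then show ?thesis unfolding rsmith_def using le by (intro enn2real_mono) auto
qed

lemma load_nonneg: "assignment G x \<Longrightarrow> k \<in> players G \<Longrightarrow> 0 \<le> load G x e k"
  by (auto simp: load_def assignment_def intro!: sum_nonneg)

lemma load_le_one:
  assumes "assignment G x" "k \<in> players G"
  shows "load G x e k \<le> 1"
proof -
  have "load G x e k \<le> (\<Sum>i\<in>strategies G k. x k i)"
    unfolding load_def using assms finite_strategies[OF assms(2)]
    by (intro sum_mono2) (auto simp: assignment_def)
  then show ?thesis using assms by (simp add: assignment_def)
qed

text \<open>Exchanging the sums replaces probabilities of strategies by loads, which allows
  comparisons resource by resource.\<close>

lemma sum_strategies_load:
  assumes "j \<in> players G"
  shows "(\<Sum>i\<in>strategies G j. x j i * (\<Sum>e\<in>i. F e)) = (\<Sum>e\<in>resources G. load G x e j * F e)"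
proof -
  have "(\<Sum>i\<in>strategies G j. x j i * (\<Sum>e\<in>i. F e))
      = (\<Sum>i\<in>strategies G j. \<Sum>e\<in>resources G. if e \<in> i then x j i * F e else 0)"
  proof (intro sum.cong refl)
    fix i assume "i \<in> strategies G j"
    then have "{e \<in> resources G. e \<in> i} = i" using strategy_subset[OF assms] by auto
    then show "x j i * (\<Sum>e\<in>i. F e) = (\<Sum>e\<in>resources G. if e \<in> i then x j i * F e else 0)"
      using finite_resources by (simp add: sum_distrib_left sum.inter_filter[symmetric])
  qed
  also have "\<dots> = (\<Sum>e\<in>resources G. \<Sum>i\<in>strategies G j. if e \<in> i then x j i * F e else 0)"
    by (rule sum.swap)
  also have "\<dots> = (\<Sum>e\<in>resources G. load G x e j * F e)"
    using finite_strategies[OF assms]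
    by (simp add: load_def sum_distrib_right sum.inter_filter[symmetric])
  finally show ?thesis .
qed

text \<open>The weighted cost to \<open>j\<close> of using \<open>e\<close> with certainty. Only
  loads of the other players occur, so a deviation of \<open>j\<close> leaves it unchanged.\<close>

definition weighted_resource_cost :: "('j \<Rightarrow> 'e set \<Rightarrow> real) \<Rightarrow> 'j \<Rightarrow> 'e \<Rightarrow> real" where
  "weighted_resource_cost x j e = weight G j * rtime G e j +
     (\<Sum>k\<in>players G - {j}. weight G j * weight G k * par (rsmith G e j) (rsmith G e k) * load G x e k)"

lemma weighted_rand_cost:
  assumes j: "j \<in> players G"
  shows "weight G j * rand_cost G x j = (\<Sum>i\<in>strategies G j. x j i * (\<Sum>e\<in>i. weighted_resource_cost x j e))"
proof -
  let ?F = "\<lambda>e. rtime G e j + (\<Sum>k\<in>players G - {j}.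
           rsmith G e j / (rsmith G e j + rsmith G e k) * rtime G e k * load G x e k)"
  have F: "weighted_resource_cost x j e = weight G j * ?F e" for e
    unfolding weighted_resource_cost_def distrib_left sum_distrib_left
    by (intro arg_cong2[of _ _ _ _ "(+)"] sum.cong refl) (auto simp: rtime_eq par_def)
  have "weight G j * rand_cost G x j
      = (\<Sum>i\<in>strategies G j. weight G j * (x j i * (\<Sum>e\<in>i. ?F e)))"
    unfolding rand_cost_def by (rule sum_distrib_left)
  also have "\<dots> = (\<Sum>i\<in>strategies G j. x j i * (\<Sum>e\<in>i. weighted_resource_cost x j e))"
    by (intro sum.cong refl, unfold F sum_distrib_left[symmetric]) (rule mult.left_commute)
  finally show ?thesis .
qed

lemma nash_weighted_cost_le:
  assumes nash: "rand_nash G x" and j: "j \<in> players G" and i: "i \<in> strategies G j"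
  shows "weight G j * rand_cost G x j \<le> (\<Sum>e\<in>i. weighted_resource_cost x j e)"
proof -
  let ?x = "deviate x j i"
  have "load G ?x e k = load G x e k" if "k \<noteq> j" for e k
    using that by (simp add: load_def deviate_def)
  then have cost: "weighted_resource_cost ?x j e = weighted_resource_cost x j e" for e
    by (simp add: weighted_resource_cost_def)
  have "weight G j * rand_cost G x j \<le> weight G j * rand_cost G ?x j"
    using nash j i weight_pos[OF j] by (simp add: rand_nash_def)
  also have "\<dots> = (\<Sum>i'\<in>strategies G j. (if i' = i then \<Sum>e\<in>i'. weighted_resource_cost x j e else 0))"
    unfolding weighted_rand_cost[OF j] cost by (intro sum.cong) (auto simp: deviate_def)
  also have "\<dots> = (\<Sum>e\<in>i. weighted_resource_cost x j e)"
    using finite_strategies[OF j] i by simp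
  finally show ?thesis .
qed

lemma rand_social_cost_eq:
  "rand_social_cost G x = (\<Sum>e\<in>resources G. \<Sum>j\<in>players G. load G x e j * weighted_resource_cost x j e)"
proof -
  have "rand_social_cost G x
      = (\<Sum>j\<in>players G. \<Sum>e\<in>resources G. load G x e j * weighted_resource_cost x j e)"
    unfolding rand_social_cost_def by (simp add: weighted_rand_cost sum_strategies_load)
  also have "\<dots> = (\<Sum>e\<in>resources G. \<Sum>j\<in>players G. load G x e j * weighted_resource_cost x j e)"
    by (rule sum.swap)
  finally show ?thesis .
qed

text \<open>The left-hand side is the squared norm of \<open>v0\<close> without its factor 9/16.
  Off-diagonal terms coincide with those of the social cost; a diagonal term is half the squared
  load times a weighted processing time, and loads are at most 1.\<close>

lemma load_form_le_rand_social_cost: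
  assumes x: "assignment G x"
  shows "(\<Sum>e\<in>resources G. \<Sum>j\<in>players G. \<Sum>k\<in>players G.
            load G x e j * load G x e k * (weight G j * weight G k) * par (rsmith G e j) (rsmith G e k))
         \<le> rand_social_cost G x"
  unfolding rand_social_cost_eq
proof (rule sum_mono, goal_cases)
  case (1 e)
  let ?f = "\<lambda>j k. load G x e j * load G x e k * (weight G j * weight G k) *
                  par (rsmith G e j) (rsmith G e k)"
  have "(\<Sum>k\<in>players G. ?f j k) \<le> load G x e j * weighted_resource_cost x j e"
    if j: "j \<in> players G" for j
  proof -
    have z: "0 \<le> load G x e j" "load G x e j \<le> 1"
      using load_nonneg[OF x j] load_le_one[OF x j] by auto
    have "load G x e j * load G x e j \<le> load G x e j * 1"
      using z by (intro mult_left_mono)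
    also have "\<dots> \<le> 2 * load G x e j" using z by simp
    finally have sq: "load G x e j * load G x e j \<le> 2 * load G x e j" .
    have "load G x e j * load G x e j * (weight G j * weight G j * rsmith G e j / 2)
        \<le> 2 * load G x e j * (weight G j * weight G j * rsmith G e j / 2)"
      using rsmith_nonneg weight_pos[OF j] by (intro mult_right_mono[OF sq]) auto
    then have "?f j j \<le> load G x e j * (weight G j * rtime G e j)"
      using j by (simp add: par_self rtime_eq algebra_simps)
    moreover have "(\<Sum>k\<in>players G - {j}. ?f j k) = load G x e j *
        (\<Sum>k\<in>players G - {j}. weight G j * weight G k * par (rsmith G e j) (rsmith G e k) * load G x e k)"
      by (simp add: sum_distrib_left mult_ac)
    ultimately show ?thesis
      using finite_players j by (simp add: sum.remove weighted_resource_cost_def distrib_left)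
  qed
  then show ?case by (rule sum_mono)
qed

section \<open>The SDP solution built from a Nash equilibrium\<close>

lemma nash_sdp_solution:
  assumes nash: "rand_nash G x"
  shows "\<exists>d y v0 v. sdp_sr_feasible G d y v0 v \<and>
           15/32 * rand_social_cost G x \<le> sdp_sr_objective G y v0"
proof -
  have x: "assignment G x" using nash by (simp add: rand_nash_def)
  let ?E = "resources G" and ?N = "players G" and ?w = "weight G" and ?s = "rsmith G"
  \<comment> \<open>All Smith ratios that occur: one finite Gram family serves every
    resource.\<close>
  define D where "D = (\<lambda>(e, j). ?s e j) ` (?E \<times> ?N)"
  have "finite D" "\<And>a. a \<in> D \<Longrightarrow> 0 \<le> a"
    using finite_players finite_resources rsmith_nonneg by (auto simp: D_def)
  then obtain u where u: "\<forall>a\<in>D. \<forall>c\<in>D. (\<Sum>b\<in>D. u a b * u c b) = par a c"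
    using par_gram by blast
  have u: "(\<Sum>b\<in>D. u (?s e j) b * u (?s e k) b) = par (?s e j) (?s e k)"
    if "e \<in> ?E" "j \<in> ?N" "k \<in> ?N" for e j k
  proof -
    have "?s e j \<in> D" "?s e k \<in> D" using that by (force simp: D_def)+
    then show ?thesis using u by blast
  qed
  \<comment> \<open>The factor \<open>?E\<close> gives each resource its own block of coordinates,
    so contributions of different resources are orthogonal.\<close>
  have "finite (?E \<times> D)" using \<open>finite D\<close> finite_resources by simp
  then obtain g :: "('e \<times> real \<Rightarrow> real) \<Rightarrow> real vec" where
    g: "\<And>f. g f \<in> carrier_vec (card (?E \<times> D))"
       "\<And>f f'. g f \<bullet> g f' = (\<Sum>i\<in>?E \<times> D. f i * f' i)"
    using finite_index_vec[of "?E \<times> D"] by blast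
  have gg: "g f \<bullet> g f' = (\<Sum>e\<in>?E. \<Sum>b\<in>D. f (e, b) * f' (e, b))" for f f'
    by (simp add: g(2) sum.cartesian_product)
  define y where "y j = 3/4 * (?w j * rand_cost G x j)" for j
  define v where "v j i = g (\<lambda>(e, b). if e \<in> i then ?w j * u (?s e j) b else 0)" for j i
  define v0 where "v0 = g (\<lambda>(e, b). 3/4 * (\<Sum>k\<in>?N. load G x e k * ?w k * u (?s e k) b))"
  \<comment> \<open>Equal pairs are included: the same formula yields the squared norms in
    \<open>yle\<close> and the inner products in \<open>vvle\<close>.\<close>
  have vv: "v j i \<bullet> v k i' = (\<Sum>e\<in>i \<inter> i'. ?w j * ?w k * par (?s e j) (?s e k))"
    if j: "j \<in> ?N" and k: "k \<in> ?N" and i: "i \<in> strategies G j" for j k i i'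
  proof -
    have "v j i \<bullet> v k i' = (\<Sum>e\<in>?E. \<Sum>b\<in>D. if e \<in> i \<inter> i'
             then ?w j * ?w k * (u (?s e j) b * u (?s e k) b) else 0)"
      unfolding v_def gg prod.case by (intro sum.cong refl) simp
    also have "\<dots> = (\<Sum>e\<in>?E. if e \<in> i \<inter> i' then ?w j * ?w k * par (?s e j) (?s e k) else 0)"
      using u j k by (intro sum.cong) (auto simp: sum_distrib_left[symmetric])
    also have "\<dots> = (\<Sum>e\<in>?E \<inter> (i \<inter> i'). ?w j * ?w k * par (?s e j) (?s e k))"
      using finite_resources by (simp add: sum.inter_restrict)
    also have "?E \<inter> (i \<inter> i') = i \<inter> i'" using strategy_subset[OF j i] by auto
    finally show ?thesis .
  qed
  have v0v: "v0 \<bullet> v j i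
      = (\<Sum>e\<in>i. 3/4 * (\<Sum>k\<in>?N. ?w j * ?w k * par (?s e j) (?s e k) * load G x e k))"
    if j: "j \<in> ?N" and i: "i \<in> strategies G j" for j i
  proof -
    have "v0 \<bullet> v j i = (\<Sum>e\<in>?E. if e \<in> i then 3/4 *
            (\<Sum>k\<in>?N. ?w j * ?w k * par (?s e j) (?s e k) * load G x e k) else 0)"
      unfolding v_def v0_def gg prod.case
    proof (intro sum.cong refl)
      fix e assume e: "e \<in> ?E"
      have "(\<Sum>b\<in>D. 3/4 * (\<Sum>k\<in>?N. load G x e k * ?w k * u (?s e k) b) * (?w j * u (?s e j) b))
          = 3/4 * (\<Sum>b\<in>D. \<Sum>k\<in>?N. ?w j * ?w k * load G x e k * (u (?s e j) b * u (?s e k) b))"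
        unfolding mult.assoc[of "3/4"] sum_distrib_right sum_distrib_left[symmetric, of "3/4"]
        by (intro arg_cong[where f = "(*) (3/4)"] sum.cong refl) (simp only: mult_ac)
      also have "(\<Sum>b\<in>D. \<Sum>k\<in>?N. ?w j * ?w k * load G x e k * (u (?s e j) b * u (?s e k) b))
          = (\<Sum>k\<in>?N. \<Sum>b\<in>D. ?w j * ?w k * load G x e k * (u (?s e j) b * u (?s e k) b))"
        by (rule sum.swap)
      also have "\<dots> = (\<Sum>k\<in>?N. ?w j * ?w k * par (?s e j) (?s e k) * load G x e k)"
        using u[OF e j] by (intro sum.cong) (auto simp: sum_distrib_left[symmetric])
      finally show "(\<Sum>b\<in>D. 3/4 * (\<Sum>k\<in>?N. load G x e k * ?w k * u (?s e k) b) *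
              (if e \<in> i then ?w j * u (?s e j) b else 0))
          = (if e \<in> i then 3/4 *
              (\<Sum>k\<in>?N. ?w j * ?w k * par (?s e j) (?s e k) * load G x e k) else 0)"
        by (cases "e \<in> i") (simp_all only: if_True if_False mult_zero_right sum.neutral_const)
    qed
    also have "\<dots> = (\<Sum>e\<in>?E \<inter> i. 3/4 *
            (\<Sum>k\<in>?N. ?w j * ?w k * par (?s e j) (?s e k) * load G x e k))"
      by (rule sum.inter_restrict[OF finite_resources, symmetric])
    also have "?E \<inter> i = i" using strategy_subset[OF j i] by auto
    finally show ?thesis .
  qed
  have "v0 \<bullet> v0 = (\<Sum>e\<in>?E. \<Sum>b\<in>D. 9/16 * (\<Sum>j\<in>?N. \<Sum>k\<in>?N.
          load G x e j * load G x e k * (?w j * ?w k) * (u (?s e j) b * u (?s e k) b)))"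
    unfolding v0_def gg prod.case
  proof (intro sum.cong refl)
    fix e b
    have "(3/4 * P) * (3/4 * P) = 9/16 * (P * P)" for P :: real by simp
    then show "3/4 * (\<Sum>k\<in>?N. load G x e k * ?w k * u (?s e k) b) *
          (3/4 * (\<Sum>k\<in>?N. load G x e k * ?w k * u (?s e k) b))
        = 9/16 * (\<Sum>j\<in>?N. \<Sum>k\<in>?N.
          load G x e j * load G x e k * (?w j * ?w k) * (u (?s e j) b * u (?s e k) b))"
      by (simp only: sum_product mult_ac)
  qed
  also have "\<dots> = (\<Sum>e\<in>?E. 9/16 * (\<Sum>j\<in>?N. \<Sum>k\<in>?N.
          load G x e j * load G x e k * (?w j * ?w k) * par (?s e j) (?s e k)))"
  proof (intro sum.cong refl)
    fix e assume e: "e \<in> ?E"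
    let ?c = "\<lambda>j k. load G x e j * load G x e k * (?w j * ?w k)"
    have "(\<Sum>b\<in>D. \<Sum>j\<in>?N. \<Sum>k\<in>?N. ?c j k * (u (?s e j) b * u (?s e k) b))
        = (\<Sum>j\<in>?N. \<Sum>b\<in>D. \<Sum>k\<in>?N. ?c j k * (u (?s e j) b * u (?s e k) b))"
      by (rule sum.swap)
    also have "\<dots> = (\<Sum>j\<in>?N. \<Sum>k\<in>?N. \<Sum>b\<in>D. ?c j k * (u (?s e j) b * u (?s e k) b))"
      by (rule sum.cong[OF refl], rule sum.swap)
    also have "\<dots> = (\<Sum>j\<in>?N. \<Sum>k\<in>?N. ?c j k * par (?s e j) (?s e k))"
      using u[OF e] by (intro sum.cong refl) (simp add: sum_distrib_left[symmetric])
    finally show "(\<Sum>b\<in>D. 9/16 * (\<Sum>j\<in>?N. \<Sum>k\<in>?N. ?c j k * (u (?s e j) b * u (?s e k) b)))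
        = 9/16 * (\<Sum>j\<in>?N. \<Sum>k\<in>?N. ?c j k * par (?s e j) (?s e k))"
      by (simp only: sum_distrib_left[symmetric])
  qed
  also have "\<dots> \<le> 9/16 * rand_social_cost G x"
    using load_form_le_rand_social_cost[OF x] by (simp only: sum_distrib_left[symmetric])
  finally have v0v0: "v0 \<bullet> v0 \<le> 9/16 * rand_social_cost G x" .
  have yle: "y j \<le> (\<Sum>e\<in>i. ?w j * rtime G e j) - 1/2 * (v j i \<bullet> v j i) + v0 \<bullet> v j i"
    if j: "j \<in> ?N" and i: "i \<in> strategies G j" for j i
  proof -
    \<comment> \<open>The two sides differ exactly by the summand \<open>k = j\<close> of the last
      sum, which is nonnegative.\<close>
    have le: "3/4 * weighted_resource_cost x j e \<le> ?w j * rtime G e j - 1/2 * (?w j * ?w j * par (?s e j) (?s e j))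
        + 3/4 * (\<Sum>k\<in>?N. ?w j * ?w k * par (?s e j) (?s e k) * load G x e k)" for e
    proof -
      have "0 \<le> ?w j * ?w j * par (?s e j) (?s e j) * load G x e j"
        using weight_pos[OF j] load_nonneg[OF x j] par_nonneg[OF rsmith_nonneg rsmith_nonneg]
        by (intro mult_nonneg_nonneg) auto
      then show ?thesis
        using finite_players j
        by (simp add: weighted_resource_cost_def sum.remove par_self rtime_eq)
    qed
    have "y j \<le> (\<Sum>e\<in>i. 3/4 * weighted_resource_cost x j e)"
      unfolding y_def sum_distrib_left[symmetric]
      using nash_weighted_cost_le[OF nash j i] by simp
    also have "\<dots> \<le> (\<Sum>e\<in>i. ?w j * rtime G e j - 1/2 * (?w j * ?w j * par (?s e j) (?s e j))
        + 3/4 * (\<Sum>k\<in>?N. ?w j * ?w k * par (?s e j) (?s e k) * load G x e k))"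
      by (rule sum_mono[OF le])
    also have "\<dots> = (\<Sum>e\<in>i. ?w j * rtime G e j) - 1/2 * (v j i \<bullet> v j i) + v0 \<bullet> v j i"
      using j i by (simp only: vv v0v sum.distrib sum_subtractf sum_distrib_left Int_absorb)
    finally show ?thesis .
  qed
  have vvle: "v j i \<bullet> v k i' \<le> (\<Sum>e\<in>i \<inter> i'. ?w j * ?w k * min (?s e j) (?s e k))"
    if "j \<in> ?N" "k \<in> ?N" "i \<in> strategies G j" for j k i i'
    unfolding vv[OF that] using weight_pos that par_le_min rsmith_nonneg
    by (intro sum_mono mult_left_mono) (auto simp: less_imp_le)
  have "sdp_sr_feasible G (card (?E \<times> D)) y v0 v"
    unfolding sdp_sr_feasible_def using yle vvle by (auto simp: v_def v0_def g(1))
  moreover have "15/32 * rand_social_cost G x \<le> sdp_sr_objective G y v0"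
  proof -
    have "(\<Sum>j\<in>?N. y j) = 3/4 * rand_social_cost G x"
      by (simp add: y_def rand_social_cost_def sum_distrib_left)
    then show ?thesis using v0v0 by (simp add: sdp_sr_objective_def)
  qed
  ultimately show ?thesis by blast
qed

section \<open>Weak duality against pure assignments\<close>

lemma pure_assignment_choice:
  assumes "pure_assignment G x"
  obtains c where "\<And>j. j \<in> players G \<Longrightarrow> c j \<in> strategies G j"
    and "\<And>j i. j \<in> players G \<Longrightarrow> i \<in> strategies G j \<Longrightarrow> x j i = (if i = c j then 1 else 0)"
proof -
  have "\<exists>c\<in>strategies G j. \<forall>i\<in>strategies G j. x j i = (if i = c then 1 else 0)"
    if j: "j \<in> players G" for j
  proof -
    have fin: "finite (strategies G j)" using finite_strategies[OF j] .
    have sum: "(\<Sum>i\<in>strategies G j. x j i) = 1" and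
      ge: "\<And>i. i \<in> strategies G j \<Longrightarrow> 0 \<le> x j i" and
      bin: "\<And>i. i \<in> strategies G j \<Longrightarrow> x j i = 0 \<or> x j i = 1"
      using assms j by (auto simp: pure_assignment_def assignment_def)
    obtain c where c: "c \<in> strategies G j" "x j c = 1"
      using sum bin by (metis sum.neutral zero_neq_one)
    have "(\<Sum>i\<in>strategies G j - {c}. x j i) = 0"
      using sum c fin by (simp add: sum.remove)
    then have "\<And>i. i \<in> strategies G j - {c} \<Longrightarrow> x j i = 0"
      using fin ge by (subst (asm) sum_nonneg_eq_0_iff) auto
    with c show ?thesis by (intro bexI[of _ c]) auto
  qed
  then show thesis using that by metis
qed

text \<open>The constraints are used only at the chosen strategies. Let \<open>s\<close> be the sum
  of the vectors \<open>v j (c j)\<close>. The terms with \<open>v0\<close> are at most half the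
  squared norm of \<open>s\<close>; its diagonal part cancels against the norms in the constraints
  on \<open>y\<close>, and its cross terms are bounded by minima of Smith ratios, which add up to
  the waiting costs.\<close>

lemma sdp_weak_duality:
  assumes feas: "sdp_sr_feasible G d y v0 v" and pure: "pure_assignment G x"
  shows "sdp_sr_objective G y v0 \<le> smith_social_cost G x"
proof -
  let ?N = "players G" and ?w = "weight G" and ?s = "rsmith G"
  obtain c where c: "\<And>j. j \<in> ?N \<Longrightarrow> c j \<in> strategies G j"
    and xc: "\<And>j i. j \<in> ?N \<Longrightarrow> i \<in> strategies G j \<Longrightarrow> x j i = (if i = c j then 1 else 0)"
    using pure_assignment_choice[OF pure] by blast
  define m where "m e j k = ?w j * ?w k * min (?s e j) (?s e k)" for e j k
  have load: "load G x e k = (if e \<in> c k then 1 else 0)" if "k \<in> ?N" for e k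
  proof -
    have "load G x e k = (\<Sum>i\<in>{i \<in> strategies G k. e \<in> i}. if i = c k then 1 else 0)"
      unfolding load_def using xc[OF that] by (intro sum.cong) auto
    then show ?thesis using finite_strategies[OF that] c[OF that] by simp
  qed
  have dim: "dim_vec v0 = d" "\<And>j. j \<in> ?N \<Longrightarrow> dim_vec (v j (c j)) = d"
    using feas c by (auto simp: sdp_sr_feasible_def)
  have "(\<Sum>j\<in>?N. y j) \<le> (\<Sum>j\<in>?N. (\<Sum>e\<in>c j. ?w j * rtime G e j)
          - 1/2 * (v j (c j) \<bullet> v j (c j)) + v0 \<bullet> v j (c j))"
    using feas c by (intro sum_mono) (auto simp: sdp_sr_feasible_def)
  then have 1: "sdp_sr_objective G y v0 \<le> (\<Sum>j\<in>?N. \<Sum>e\<in>c j. ?w j * rtime G e j)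
      + ((\<Sum>j\<in>?N. v0 \<bullet> v j (c j)) - 1/2 * (\<Sum>j\<in>?N. v j (c j) \<bullet> v j (c j)) - 1/2 * (v0 \<bullet> v0))"
    by (simp add: sdp_sr_objective_def sum.distrib sum_subtractf sum_distrib_left)
  \<comment> \<open>The square is completed coordinate by coordinate, without forming a sum of
    vectors.\<close>
  define a where "a j n = v j (c j) $ n" for j n
  have vv: "v j (c j) \<bullet> v k (c k) = (\<Sum>n<d. a j n * a k n)" if "k \<in> ?N" for j k
    using dim that by (simp add: scalar_prod_def a_def atLeast0LessThan)
  have v0v: "v0 \<bullet> v k (c k) = (\<Sum>n<d. v0 $ n * a k n)" if "k \<in> ?N" for k
    using dim that by (simp add: scalar_prod_def a_def atLeast0LessThan)
  have v0v0: "v0 \<bullet> v0 = (\<Sum>n<d. v0 $ n * v0 $ n)"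
    using dim by (simp add: scalar_prod_def atLeast0LessThan)
  \<comment> \<open>Here \<open>q\<close> and \<open>t\<close> will be the diagonal and off-diagonal
    parts of the squared norm of the vector sum, and \<open>r\<close> that of
    \<open>v0\<close>.\<close>
  have rearrange: "p - 1/2 * q - 1/2 * r \<le> 1/2 * t"
    if "p \<le> 1/2 * r + 1/2 * (q + t)" for p q r t :: real
    using that by (simp add: field_simps)
  have "(\<Sum>j\<in>?N. v0 \<bullet> v j (c j)) = (\<Sum>n<d. v0 $ n * (\<Sum>j\<in>?N. a j n))"
    by (simp add: v0v sum_distrib_left) (rule sum.swap)
  also have "\<dots> \<le> (\<Sum>n<d. 1/2 * (v0 $ n * v0 $ n) + 1/2 * ((\<Sum>j\<in>?N. a j n) * (\<Sum>j\<in>?N. a j n)))"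
  proof (rule sum_mono)
    fix n
    show "v0 $ n * (\<Sum>j\<in>?N. a j n)
        \<le> 1/2 * (v0 $ n * v0 $ n) + 1/2 * ((\<Sum>j\<in>?N. a j n) * (\<Sum>j\<in>?N. a j n))"
      using sum_squares_bound[of "v0 $ n" "\<Sum>j\<in>?N. a j n"] by (simp add: power2_eq_square)
  qed
  also have "\<dots> = 1/2 * (v0 \<bullet> v0) + 1/2 * (\<Sum>n<d. \<Sum>j\<in>?N. \<Sum>k\<in>?N. a j n * a k n)"
    by (simp only: v0v0 sum.distrib sum_product) (simp only: sum_distrib_left[symmetric])
  also have "(\<Sum>n<d. \<Sum>j\<in>?N. \<Sum>k\<in>?N. a j n * a k n) = (\<Sum>j\<in>?N. \<Sum>k\<in>?N. \<Sum>n<d. a j n * a k n)"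
    by (subst sum.swap) (rule sum.cong[OF refl], rule sum.swap)
  also have "\<dots> = (\<Sum>j\<in>?N. \<Sum>k\<in>?N. v j (c j) \<bullet> v k (c k))"
    by (simp add: vv)
  also have "\<dots> = (\<Sum>j\<in>?N. v j (c j) \<bullet> v j (c j)) + (\<Sum>j\<in>?N. \<Sum>k\<in>?N - {j}. v j (c j) \<bullet> v k (c k))"
    by (rule sum_split_diagonal[OF finite_players])
  finally have 2: "(\<Sum>j\<in>?N. v0 \<bullet> v j (c j)) - 1/2 * (\<Sum>j\<in>?N. v j (c j) \<bullet> v j (c j)) - 1/2 * (v0 \<bullet> v0)
      \<le> 1/2 * (\<Sum>j\<in>?N. \<Sum>k\<in>?N - {j}. v j (c j) \<bullet> v k (c k))"
    by (rule rearrange)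
  \<comment> \<open>The players differ, so the index pairs are distinct even if
    \<open>c j = c k\<close>, and the constraint applies.\<close>
  have "(\<Sum>j\<in>?N. \<Sum>k\<in>?N - {j}. v j (c j) \<bullet> v k (c k))
      \<le> (\<Sum>j\<in>?N. \<Sum>k\<in>?N - {j}. \<Sum>e\<in>c j \<inter> c k. m e j k)"
    unfolding m_def using feas c by (intro sum_mono) (auto simp: sdp_sr_feasible_def)
  also have "\<dots> = 2 * (\<Sum>j\<in>?N. \<Sum>e\<in>c j. \<Sum>k\<in>{k \<in> ?N. (k, j) \<in> prec G e}. ?w j * (rtime G e k * load G x e k))"
  proof -
    \<comment> \<open>Extension by zero makes the range of resources independent of the players, so
      that the sums can be exchanged.\<close>
    let ?t = "\<lambda>e j k. if e \<in> c j \<inter> c k then m e j k else 0"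
    let ?P = "\<lambda>e j. {k \<in> ?N. (k, j) \<in> prec G e}"
    have extend: "(\<Sum>e\<in>c j \<inter> A. F e) = (\<Sum>e\<in>resources G. if e \<in> c j \<inter> A then F e else 0)"
      if "j \<in> ?N" for j A and F :: "'e \<Rightarrow> real"
    proof -
      have "resources G \<inter> (c j \<inter> A) = c j \<inter> A" using strategy_subset[OF that c[OF that]] by auto
      then show ?thesis using sum.inter_restrict[OF finite_resources, of F "c j \<inter> A"] by simp
    qed
    have "(\<Sum>j\<in>?N. \<Sum>k\<in>?N - {j}. \<Sum>e\<in>c j \<inter> c k. m e j k)
        = (\<Sum>j\<in>?N. \<Sum>k\<in>?N - {j}. \<Sum>e\<in>resources G. ?t e j k)"
      by (rule sum.cong[OF refl], rule sum.cong[OF refl], rule extend)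
    also have "\<dots> = (\<Sum>j\<in>?N. \<Sum>e\<in>resources G. \<Sum>k\<in>?N - {j}. ?t e j k)"
      by (rule sum.cong[OF refl], rule sum.swap)
    also have "\<dots> = (\<Sum>e\<in>resources G. \<Sum>j\<in>?N. \<Sum>k\<in>?N - {j}. ?t e j k)"
      by (rule sum.swap)
    also have "\<dots> = (\<Sum>e\<in>resources G. 2 * (\<Sum>j\<in>?N. \<Sum>k\<in>?P e j. ?t e j k))"
      using game finite_players
      by (intro sum.cong refl sum_symmetric_strict_linear_order)
         (auto simp: congestion_game_def m_def min.commute)
    also have "\<dots> = 2 * (\<Sum>j\<in>?N. \<Sum>e\<in>resources G. \<Sum>k\<in>?P e j. ?t e j k)"
      unfolding sum_distrib_left[symmetric] by (subst sum.swap) (rule refl)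
    also have "(\<Sum>j\<in>?N. \<Sum>e\<in>resources G. \<Sum>k\<in>?P e j. ?t e j k)
        = (\<Sum>j\<in>?N. \<Sum>e\<in>resources G. if e \<in> c j
             then \<Sum>k\<in>?P e j. ?w j * (rtime G e k * load G x e k) else 0)"
    proof -
      \<comment> \<open>A predecessor \<open>k\<close> attains the minimum, and its ratio times its
        weight is its processing time.\<close>
      have "m e j k = ?w j * rtime G e k" if "j \<in> ?N" "k \<in> ?P e j" "e \<in> c j" for e j k
        using that rsmith_mono_prec[OF that(1) c that(3), of k] by (simp add: m_def rtime_eq min_absorb2)
      then show ?thesis by (intro sum.cong refl) (auto simp: load intro!: sum.cong)
    qed
    also have "\<dots> = (\<Sum>j\<in>?N. \<Sum>e\<in>c j. \<Sum>k\<in>?P e j. ?w j * (rtime G e k * load G x e k))"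
      by (rule sum.cong[OF refl]) (simp add: extend[where A = UNIV, simplified])
    finally show ?thesis .
  qed
  finally have 3: "(\<Sum>j\<in>?N. \<Sum>k\<in>?N - {j}. v j (c j) \<bullet> v k (c k))
      \<le> 2 * (\<Sum>j\<in>?N. \<Sum>e\<in>c j. \<Sum>k\<in>{k \<in> ?N. (k, j) \<in> prec G e}. ?w j * (rtime G e k * load G x e k))" .
  have "smith_social_cost G x = (\<Sum>j\<in>?N. ?w j * (\<Sum>e\<in>c j. rtime G e j +
              (\<Sum>k\<in>{k\<in>?N. (k, j) \<in> prec G e}. rtime G e k * load G x e k)))"
  proof -
    have "(\<Sum>i\<in>strategies G j. x j i * F i) = F (c j)" if "j \<in> ?N" for j and F :: "'e set \<Rightarrow> real"
    proof -
      have "(\<Sum>i\<in>strategies G j. x j i * F i) = (\<Sum>i\<in>strategies G j. if i = c j then F i else 0)"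
        using xc[OF that] by (intro sum.cong) auto
      then show ?thesis using finite_strategies[OF that] c[OF that] by simp
    qed
    then show ?thesis unfolding smith_social_cost_def by simp
  qed
  also have "\<dots> = (\<Sum>j\<in>?N. \<Sum>e\<in>c j. ?w j * rtime G e j)
     + (\<Sum>j\<in>?N. \<Sum>e\<in>c j. \<Sum>k\<in>{k\<in>?N. (k, j) \<in> prec G e}. ?w j * (rtime G e k * load G x e k))"
    by (simp add: distrib_left sum_distrib_left sum.distrib)
  finally show ?thesis using 1 2 3 by linarith
qed

end

theorem theorem4p7:
  fixes G :: "('e, 'j) congestion_instance"
  assumes "congestion_game G"
  shows "(\<forall>x. rand_nash G x \<longrightarrow>
            (\<exists>d y v0 v. sdp_sr_feasible G d y v0 v \<and>
               sdp_sr_objective G y v0 \<ge> 15/32 * rand_social_cost G x))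
       \<and> rand_coordination_ratio G \<le> 32/15
       \<and> (\<forall>x x'. rand_nash G x \<longrightarrow> pure_assignment G x' \<longrightarrow>
            rand_social_cost G x \<le> 32/15 * smith_social_cost G x')"
proof (intro conjI allI impI)
  show bound: "rand_social_cost G x \<le> 32/15 * smith_social_cost G x'"
    if nash: "rand_nash G x" and pure: "pure_assignment G x'" for x x'
  proof -
    obtain d y v0 v where feas: "sdp_sr_feasible G d y v0 v"
      and obj: "15/32 * rand_social_cost G x \<le> sdp_sr_objective G y v0"
      using nash_sdp_solution[OF assms nash] by blast
    show ?thesis using obj sdp_weak_duality[OF assms feas pure] by simp
  qed
  show "rand_coordination_ratio G \<le> 32/15"
    unfolding rand_coordination_ratio_def
  proof (rule SUP_least)
    fix x assume "x \<in> {x. rand_nash G x}"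
    then have nash: "rand_nash G x" by simp
    let ?m = "INF x'\<in>{x'. pure_assignment G x'}. ennreal (smith_social_cost G x')"
    \<comment> \<open>The constant stands on the left so that a fixed quantity is compared with
      every member of the infimum.\<close>
    have "ennreal (15/32 * rand_social_cost G x) \<le> ?m"
      using bound[OF nash] by (intro INF_greatest ennreal_leI) (simp add: field_simps)
    then have "ennreal (32/15) * ennreal (15/32 * rand_social_cost G x) \<le> ennreal (32/15) * ?m"
      by (rule mult_left_mono) simp
    then have "ennreal (rand_social_cost G x) \<le> ennreal (32/15) * ?m"
      by (simp add: ennreal_mult'[symmetric])
    \<comment> \<open>If \<open>?m = 0\<close>, the preceding bound forces the numerator to be 0 in
      \<open>ennreal\<close>, and the quotient is 0 by convention.\<close>
    then have "ennreal (rand_social_cost G x) / ?m \<le> ennreal (32/15)"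
      by (cases "?m = 0") (auto intro: divide_le_posI_ennreal simp: mult.commute zero_less_iff_neq_zero)
    then show "ennreal (rand_social_cost G x) / ?m \<le> 32/15"
      by (simp add: divide_ennreal[symmetric])
  qed
qed (use nash_sdp_solution[OF assms] in blast)

end
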